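(* Let $b,c \in \mathbb{N}$ with $b \ge 2$ and $c \ge 5$, and let $p = 2 - \frac{2}{c}$. If $b < \frac{2+p^c}{p}$, then $\mathrm{dor}(1,b) \le c-1$.
   Context: For integers $1 \le a \le b$, an $(a,b)$-triple is a triple $(x, ax+d, bx+2d)$ with $x,d$ positive integers. A coloring admits a monochromatic $(a,b)$-triple if all three entries of some $(a,b)$-triple receive the same color. The pair $(a,b)$ is $r$-regular if every $r$-coloring of $\mathbb{N}$ admits a monochromatic $(a,b)$-triple. The degree of regularity $\mathrm{dor}(a,b)$ is the largest $r$ such that $(a,b)$ is $r$-regular, and $\mathrm{dor}(a,b)=\infty$ if $(a,b)$ is $r$-regular for all $r$. *)

theory Defs
  imports Complex_Main "HOL-Library.FuncSet" "HOL-Library.Extended_Nat"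
begin

definition is_triple :: "nat \<Rightarrow> nat \<Rightarrow> nat \<times> nat \<times> nat \<Rightarrow> bool" where
  "is_triple a b t \<longleftrightarrow> (\<exists>x d. 0 < x \<and> 0 < d \<and> t = (x, a * x + d, b * x + 2 * d))"

text \<open>Colorings are colorings of the positive integers; values at \<open>0\<close> are irrelevant.\<close>

definition admits_mono_triple :: "nat \<Rightarrow> nat \<Rightarrow> (nat \<Rightarrow> nat) \<Rightarrow> bool" where
  "admits_mono_triple a b \<chi> \<longleftrightarrow> (\<exists>x y z. is_triple a b (x, y, z) \<and> \<chi> x = \<chi> y \<and> \<chi> y = \<chi> z)"

definition regular :: "nat \<Rightarrow> nat \<Rightarrow> nat \<Rightarrow> bool" where
  "regular r a b \<longleftrightarrow> (\<forall>\<chi> \<in> {1..} \<rightarrow> {..<r}. admits_mono_triple a b \<chi>)"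

text \<open>The number of colors is positive. By the two lemmas after the definition, the numbers
  \<open>r \<ge> 1\<close> for which \<open>(a, b)\<close> is \<open>r\<close>-regular contain \<open>1\<close> and are downward closed, so the greatest
  one exists as soon as regularity fails for some \<open>r\<close>.\<close>

definition dor :: "nat \<Rightarrow> nat \<Rightarrow> enat" where
  "dor a b =
    (if \<forall>r\<ge>1. regular r a b then \<infinity> else enat (GREATEST r. 1 \<le> r \<and> regular r a b))"

lemma regular_1: "regular 1 a b"
  unfolding regular_def
proof
  fix \<chi> :: "nat \<Rightarrow> nat"
  assume "\<chi> \<in> {1..} \<rightarrow> {..<1}"
  then have z: "\<chi> n = 0" if "1 \<le> n" for n
    using that by (auto simp: Pi_iff)
  have "is_triple a b (1, a * 1 + 1, b * 1 + 2 * 1)"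
    unfolding is_triple_def by (intro exI[of _ 1]) simp
  moreover have "\<chi> 1 = \<chi> (a * 1 + 1)" "\<chi> (a * 1 + 1) = \<chi> (b * 1 + 2 * 1)"
    by (simp_all add: z)
  ultimately show "admits_mono_triple a b \<chi>"
    unfolding admits_mono_triple_def by blast
qed

lemma regular_antimono: "regular s a b" if "regular r a b" "s \<le> r"
proof -
  have "({1..} \<rightarrow> {..<s}) \<subseteq> ({1..} \<rightarrow> {..<r})"
    using that(2) by (intro Pi_mono) auto
  then show ?thesis using that(1) unfolding regular_def by blast
qed

lemma enat_le_dor_iff: "enat r \<le> dor a b \<longleftrightarrow> regular r a b" if "1 \<le> r"
proof (cases "\<forall>r\<ge>1. regular r a b")
  case True
  then show ?thesis using that by (simp add: dor_def)
next
  case False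
  then obtain m where m: "\<not> regular m a b" by blast
  let ?P = "\<lambda>r. 1 \<le> r \<and> regular r a b"
  have bd: "k \<le> m" if "?P k" for k
    proof (rule ccontr)
    assume "\<not> k \<le> m"
    then show False using m regular_antimono[of k a b m] that by simp
  qed
  have G: "?P (Greatest ?P)"
    by (rule GreatestI_nat[of ?P 1 m]) (use regular_1 bd in auto)
  have "k \<le> Greatest ?P" if "?P k" for k
    by (rule Greatest_le_nat[of ?P k m]) (use that bd in auto)
  then have "r \<le> Greatest ?P \<longleftrightarrow> regular r a b"
    using G regular_antimono[of "Greatest ?P" a b r] that by blast
  then show ?thesis using False unfolding dor_def by (simp only: if_False enat_ord_simps)
qed

end

(* Colour n by floor (log2 n) mod c. A triple (x, x + d, b x + 2 d) satisfies
   z = 2 y + (b - 2) x with x < y, hence 2 y <= z <= b y. The lower bound puts y and z in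
   different dyadic blocks, so if their colours agree these blocks are at least c apart, which
   forces z > 2^(c-1) y. This is impossible when b <= 2^(c-1), a consequence of the bound on b
   in terms of p because 1 <= p < 2. *)
theory Submission
  imports Defs "HOL-Library.Discrete_Functions"
begin

text \<open>Doubling \<open>m\<close> raises \<open>floor_log\<close> by exactly one, so
  \<open>n\<close> lies in a strictly later dyadic block; a positive difference divisible by
  \<open>c\<close> is at least \<open>c\<close>.\<close>

lemma floor_log_add_le:
  fixes m n c :: nat
  assumes "0 < m" "2 * m \<le> n" "floor_log m mod c = floor_log n mod c"
  shows "floor_log m + c \<le> floor_log n"
proof -
  have "floor_log (2 * m) \<le> floor_log n"
    using assms(2) by (rule floor_log_le_iff)
  then have less: "floor_log m < floor_log n"
    using assms(1) by (simp)
  have "c dvd floor_log n - floor_log m"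
    using assms(3) less by (metis mod_eq_dvd_iff_nat less_imp_le)
  then have "c \<le> floor_log n - floor_log m"
    using less by (intro dvd_imp_le) simp_all
  then show ?thesis
    using less by linarith
qed

lemma not_regular_if_le_power:
  fixes b c :: nat
  assumes b: "2 \<le> b" "b \<le> 2 ^ (c - 1)" and c: "0 < c"
  shows "\<not> regular c 1 b"
proof
  assume "regular c 1 b"
  moreover have "(\<lambda>n. floor_log n mod c) \<in> {1..} \<rightarrow> {..<c}"
    using c by simp
  ultimately have "admits_mono_triple 1 b (\<lambda>n. floor_log n mod c)"
    unfolding regular_def by blast
  then obtain x d where xd: "0 < x" "0 < d"
    and col: "floor_log (x + d) mod c = floor_log (b * x + 2 * d) mod c"
    unfolding admits_mono_triple_def is_triple_def by auto
  define y z where "y = x + d" and "z = b * x + 2 * d"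
  \<comment> \<open>The slack is \<open>(b - 2) * x\<close> in the lower bound and
    \<open>(b - 2) * d\<close> in the upper one, so both rest on \<open>2 <= b\<close>.\<close>
  have y: "0 < y" and lower: "2 * y \<le> z" and upper: "z \<le> b * y"
    using xd b(1) by (auto simp: y_def z_def algebra_simps)
  have "floor_log y + c \<le> floor_log z"
    using floor_log_add_le[OF y lower] col by (simp add: y_def z_def)
  then have "2 ^ (floor_log y + c) \<le> (2::nat) ^ floor_log z"
    by (rule power_increasing) simp
  also have "\<dots> \<le> z"
    using y lower by (intro floor_log_exp2_le) simp
  also have "\<dots> \<le> 2 ^ (c - 1) * y"
    using upper b(2) by (meson le_trans mult_le_mono1)
  \<comment> \<open>The strict inequality closing the cycle is
    \<open>y < 2 ^ (floor_log y + 1)\<close>: \<open>y\<close> lies below the end of its dyadic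
    block.\<close>
  also have "\<dots> < 2 ^ (c - 1) * (2 * 2 ^ floor_log y)"
    using floor_log_exp2_gt[of y] by simp
  also have "\<dots> = 2 ^ (floor_log y + c)"
    using c by (cases c) (simp_all add: power_add)
  finally show False by simp
qed

text \<open>With \<open>n = m + 1\<close>, the right side is
  \<open>q * (q ^ m - p ^ m) + (q - p) * p ^ m\<close>, where the first summand is nonnegative and
  \<open>p ^ m\<close> is at least 1.\<close>

lemma power_diff_ge_diff:
  fixes p q :: real
  assumes "1 \<le> p" "p \<le> q" "0 < n"
  shows "q - p \<le> q ^ n - p ^ n"
proof -
  obtain m where n: "n = Suc m"
    using assms(3) gr0_implies_Suc by blast
  have "q - p \<le> (q - p) * p ^ m"
    using assms mult_left_mono[of 1 "p ^ m" "q - p"] by simp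
  also have "\<dots> \<le> q * q ^ m - p * p ^ m"
    using assms mult_left_mono[of "p ^ m" "q ^ m" q] by (simp add: power_mono algebra_simps)
  finally show ?thesis by (simp add: n)
qed

theorem theorem3:
  fixes b c :: nat and p :: real
  assumes "b \<ge> 2" and "c \<ge> 5"
    and "p = 2 - 2 / real c"
    and "real b < (2 + p ^ c) / p"
  shows "dor 1 b \<le> enat (c - 1)"
proof -
  have p: "1 \<le> p" "p \<le> 2"
    using assms(2) by (auto simp: assms(3) divide_le_eq)
  \<comment> \<open>Clearing the denominator in \<open>(2 + p ^ c) / p <= 2 ^ (c - 1) + 1\<close>
    and rearranging leaves \<open>2 - p <= p * (2 ^ (c - 1) - p ^ (c - 1))\<close>.\<close>
  have "2 - p \<le> p * (2 - p)"
    using p mult_right_mono[of 1 p "2 - p"] by simp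
  also have "\<dots> \<le> p * (2 ^ (c - 1) - p ^ (c - 1))"
    using p assms(2) by (intro mult_left_mono power_diff_ge_diff) auto
  also have "\<dots> = p * 2 ^ (c - 1) - p ^ c"
    using assms(2) power_eq_if[of p c] by (simp add: right_diff_distrib)
  finally have "2 + p ^ c \<le> (2 ^ (c - 1) + 1) * p"
    by (simp add: algebra_simps)
  then have "(2 + p ^ c) / p \<le> 2 ^ (c - 1) + 1"
    using p by (simp add: divide_le_eq)
  \<comment> \<open>Both sides are integers, so the strict bound absorbs the extra 1.\<close>
  then have "real b < real (2 ^ (c - 1) + 1)"
    using assms(4) by simp
  then have "b \<le> 2 ^ (c - 1)"
    unfolding of_nat_less_iff by simp
  then have "\<not> regular c 1 b"
    using assms(1,2) by (intro not_regular_if_le_power) auto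
  then have "dor 1 b < enat c"
    using enat_le_dor_iff[of c 1 b] assms(2) by (simp add: not_le)
  then show ?thesis
    by (cases "dor 1 b") auto
qed

end
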